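(* Let $n\ge 1$ and $l\ge 1$ be natural numbers and let $\mathfrak A$ be a linearly ordered alphabet with $l$ letters. Put $$\Phi(n,l)=2^{96}\, l\cdot n^{12\log_3 n+36\log_3\log_3 n+91}.$$ Then every word over $\mathfrak A$ that is not $n$-divisible can be written as a product $$u_{1}^{k_1}u_{2}^{k_2}\cdots u_{r}^{k_r},$$ where each $u_i$ is a nonempty word over $\mathfrak A$ of length less than $n$, each $k_i\ge 1$ is a natural number, and $r\le \Phi(n,l)$. In other words, the height of the set of non-$n$-divisible words over an $l$-letter alphabet over the set of words of length less than $n$ does not exceed $\Phi(n,l)$.
   Context: Words are finite strings over $\mathfrak A$. Lexicographic order on words: for words $u,v$, $u\succ v$ if there are (possibly empty) words $w,u',v'$ and letters $a\succ b$ of $\mathfrak A$ with $u=wau'$, $v=wbv'$. Two words are incomparable iff one is a prefix of the other. A word $W$ is called $n$-divisible if it can be written as $W=v\,u_1u_2\cdots u_n$ (with $v$ possibly empty and $u_i$ nonempty) such that $u_1\succ u_2\succ\cdots\succ u_n$. The height of a set $\mathcal M$ of words over a set of words $Y$ is the minimal $h$ such that every word of $\mathcal M$ is either $n$-divisible or representable as $u_{j_1}^{k_1}\cdots u_{j_r}^{k_r}$ with $u_{j_i}\in Y$ and $r\le h$. Logarithms are to base $3$. *)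

theory Defs
  imports Complex_Main "HOL-Library.Extended_Real"
begin

text \<open>
  Words over an alphabet \<open>A\<close> are the elements of \<open>lists A\<close>. Unlike the library's
  lexicographic orders on lists, this order leaves a word and its prefixes incomparable.
\<close>

definition word_gt :: "'a::linorder list \<Rightarrow> 'a list \<Rightarrow> bool" (infix "\<succ>\<^sub>w" 50) where
  "u \<succ>\<^sub>w v \<longleftrightarrow> (\<exists>w u' v' a b. a > b \<and> u = w @ a # u' \<and> v = w @ b # v')"

definition divisible :: "nat \<Rightarrow> 'a::linorder list \<Rightarrow> bool" where
  "divisible n W \<longleftrightarrow>
     (\<exists>v us. W = v @ concat us \<and> length us = n \<and> [] \<notin> set us \<and> successively (\<succ>\<^sub>w) us)"

definition word_power :: "'a list \<Rightarrow> nat \<Rightarrow> 'a list" where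
  "word_power u k = concat (replicate k u)"

text \<open>
  The list \<open>[(u\<^sub>1, k\<^sub>1), \<dots>, (u\<^sub>r, k\<^sub>r)]\<close> encodes the product of the powers of the \<open>u\<^sub>i\<close>
  with exponents \<open>k\<^sub>i\<close>; its length is the number \<open>r\<close> of factors.
\<close>

definition power_product :: "('a list \<times> nat) list \<Rightarrow> 'a list" where
  "power_product fs = concat (map (\<lambda>(u, k). word_power u k) fs)"

definition power_factorization :: "'a list set \<Rightarrow> 'a list \<Rightarrow> ('a list \<times> nat) list \<Rightarrow> bool" where
  "power_factorization Y W fs \<longleftrightarrow>
     W = power_product fs \<and> (\<forall>(u, k) \<in> set fs. u \<in> Y \<and> k \<ge> 1)"

text \<open>The height is \<open>\<infinity>\<close> if no finite bound exists.\<close>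

definition height :: "nat \<Rightarrow> 'a::linorder list set \<Rightarrow> 'a list set \<Rightarrow> enat" where
  "height n M Y =
     Inf {enat h | h. \<forall>W\<in>M. divisible n W \<or>
                        (\<exists>fs. power_factorization Y W fs \<and> length fs \<le> h)}"

definition short_words :: "'a set \<Rightarrow> nat \<Rightarrow> 'a list set" where
  "short_words A n = {u \<in> lists A. u \<noteq> [] \<and> length u < n}"

text \<open>
  For \<open>n = 1\<close> the iterated logarithm is \<open>log 3 0\<close>, which is \<open>0\<close> here; the value chosen is
  irrelevant, since the base of the power is then \<open>1\<close>.
\<close>

definition height_bound :: "nat \<Rightarrow> nat \<Rightarrow> real" where
  "height_bound n l =
     2 ^ 96 * real l * real n powr (12 * log 3 (real n) + 36 * log 3 (log 3 (real n)) + 91)"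

end

theory Submission
  imports Defs "HOL-Library.List_Lexorder"
begin

text \<open>
  Let \<open>P\<close> be a power of two with \<open>n - 1 \<le> P \<le> 2 (n - 1)\<close>. A sequence of \<open>n\<close> positions with
  consecutive distances at least \<open>P\<close> at which strictly decreasing factors of length \<open>P\<close> start
  would make the word \<open>n\<close>-divisible. Hence, by the dual of Dilworth's theorem, the positions
  split into \<open>n - 1\<close> levels such that on each level the factors of length \<open>P\<close> increase weakly
  from any position to those at distance at least \<open>P\<close>.

  A record for length \<open>p \<le> P\<close> is a position whose factor of length \<open>p\<close> exceeds all earlier ones
  of its level. Between two consecutive records, except for the first \<open>P\<close> positions, the factor of
  length \<open>p\<close> depends only on the level. A factor of length \<open>2 p\<close> consists of two factors of length
  \<open>p\<close>, so passing from \<open>p\<close> to \<open>2 p\<close> multiplies the number of records by at most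
  \<open>2 P + (n - 1)\<^sup>2\<close>. For \<open>p = P\<close> there are at most \<open>n - 1 \<le> P\<close> different factors of
  length \<open>P\<close> on such a stretch, which by the Morse--Hedlund argument is eventually periodic with
  preperiod and period less than \<open>n\<close>, hence a product of three powers of short words.
\<close>

section \<open>Factorizations into few powers\<close>

definition height_le :: "'a list set \<Rightarrow> 'a list \<Rightarrow> nat \<Rightarrow> bool" where
  "height_le Y w h \<longleftrightarrow> (\<exists>fs. power_factorization Y w fs \<and> length fs \<le> h)"

lemma height_le_Nil: "height_le Y [] h"
  unfolding height_le_def
  by (rule exI[of _ "[]"]) (simp add: power_factorization_def power_product_def)

lemma height_le_append:
  assumes "height_le Y u g" and "height_le Y v h"
  shows "height_le Y (u @ v) (g + h)"
proof -
  obtain fs gs where "power_factorization Y u fs" "length fs \<le> g"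
    "power_factorization Y v gs" "length gs \<le> h"
    using assms unfolding height_le_def by blast
  then show ?thesis
    unfolding height_le_def
    by (intro exI[of _ "fs @ gs"]) (auto simp: power_factorization_def power_product_def)
qed

lemma height_le_mono: "height_le Y w g \<Longrightarrow> g \<le> h \<Longrightarrow> height_le Y w h"
  unfolding height_le_def by fastforce

lemma height_le_power:
  assumes "u \<in> Y"
  shows "height_le Y (word_power u k) 1"
proof (cases "k = 0")
  case True
  then show ?thesis by (simp add: word_power_def height_le_Nil)
next
  case False
  then show ?thesis
    unfolding height_le_def using assms
    by (intro exI[of _ "[(u, k)]"]) (auto simp: power_factorization_def power_product_def)
qed

lemma height_le_short:
  assumes "w \<in> lists A" and "length w < n"
  shows "height_le (short_words A n) w 1"
proof (cases "w = []")
  case True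
  then show ?thesis by (simp add: height_le_Nil)
next
  case False
  then have "w \<in> short_words A n"
    using assms by (simp add: short_words_def)
  from height_le_power[OF this, of 1] show ?thesis
    by (simp add: word_power_def)
qed

lemma height_le_length:
  assumes "w \<in> lists A" and "2 \<le> n"
  shows "height_le (short_words A n) w (length w)"
  using assms(1)
proof (induction w)
  case Nil
  then show ?case by (simp add: height_le_Nil)
next
  case (Cons a w)
  then have "height_le (short_words A n) ([a] @ w) (1 + length w)"
    using assms(2) by (intro height_le_append height_le_short) auto
  then show ?case by simp
qed

lemma periodic_word_power:
  assumes "v \<noteq> []" and "\<And>t. t < length w \<Longrightarrow> w ! t = v ! (t mod length v)"
  shows "\<exists>k. \<exists>r < length v. w = word_power v k @ take r v"
  using assms(2)
proof (induction "length w" arbitrary: w rule: less_induct)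
  case less
  show ?case
  proof (cases "length w < length v")
    case True
    then have "w = word_power v 0 @ take (length w) v"
      using less.prems by (auto intro!: nth_equalityI simp: word_power_def)
    then show ?thesis using True by blast
  next
    case False
    then have le: "length v \<le> length w" by simp
    have tk: "take (length v) w = v"
      using le less.prems by (auto intro!: nth_equalityI)
    have "drop (length v) w ! t = v ! (t mod length v)" if "t < length (drop (length v) w)" for t
      using less.prems[of "length v + t"] that le by simp
    moreover have "length (drop (length v) w) < length w"
      using assms(1) le by (cases w) auto
    ultimately obtain k r where r: "r < length v"
      and dr: "drop (length v) w = word_power v k @ take r v"
      using less.hyps by blast
    have "w = v @ drop (length v) w"
      by (metis append_take_drop_id tk)
    then have "w = word_power v (Suc k) @ take r v"
      using dr by (simp add: word_power_def)
    then show ?thesis using r by blast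
  qed
qed

section \<open>Words with few factors of a given length\<close>

definition factor :: "'a list \<Rightarrow> nat \<Rightarrow> nat \<Rightarrow> 'a list" where
  "factor W p i = take p (drop i W)"

lemma length_factor: "i + p \<le> length W \<Longrightarrow> length (factor W p i) = p"
  by (simp add: factor_def)

lemma take_factor: "q \<le> p \<Longrightarrow> take q (factor W p i) = factor W q i"
  by (simp add: factor_def min_def)

lemma factor_add: "factor W (p + q) i = factor W p i @ factor W q (i + p)"
  by (simp add: factor_def take_add add.commute)

lemma factor_in_lists: "W \<in> lists A \<Longrightarrow> factor W p i \<in> lists A"
  by (auto simp: factor_def dest!: in_set_takeD in_set_dropD)

lemma nth_factor: "t < p \<Longrightarrow> i + p \<le> length W \<Longrightarrow> factor W p i ! t = W ! (i + t)"
  by (simp add: factor_def)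

lemma factor_Suc_Cons: "i < length W \<Longrightarrow> factor W (Suc p) i = W ! i # factor W p (Suc i)"
  by (simp add: factor_def Cons_nth_drop_Suc[symmetric])

text \<open>Otherwise \<open>f\<close> would increase strictly from at least 1 and exceed
  \<open>m\<close> at \<open>m\<close>.\<close>

lemma stationary_step:
  fixes f :: "nat \<Rightarrow> nat"
  assumes "1 \<le> f 0" and "f m \<le> m" and "\<And>q. q < m \<Longrightarrow> f q \<le> f (Suc q)"
  shows "\<exists>q<m. f q = f (Suc q)"
proof (rule ccontr)
  assume "\<not> ?thesis"
  then have step: "f q < f (Suc q)" if "q < m" for q
    using assms(3) that le_neq_implies_less by blast
  have "Suc q \<le> f q" if "q \<le> m" for q
    using that by (induction q) (use assms(1) step in \<open>auto simp: Suc_le_eq intro: le_less_trans\<close>)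
  from this[of m] assms(2) show False by simp
qed

text \<open>
  The Morse--Hedlund argument: if there are as many factors of length \<open>q + 1\<close> as of length \<open>q\<close>,
  then each factor of length \<open>q\<close> determines the next one, so the sequence of factors is
  eventually periodic.
\<close>

lemma height_le_few_factors:
  assumes W: "W \<in> lists A" and n: "1 \<le> n" and Pn: "n - 1 \<le> P" and bW: "b + P \<le> length W + 1"
    and card: "card (factor W P ` {a..<b}) \<le> n - 1"
  shows "height_le (short_words A n) (factor W (b - a) a) 3"
proof (cases "b - a < n")
  case True
  have "length (factor W (b - a) a) < n"
    using True by (simp add: factor_def)
  then show ?thesis
    using height_le_short[OF factor_in_lists[OF W]] height_le_mono by fastforce
next
  case False
  then have len: "a + n \<le> b" using n by simp
  have bL: "b \<le> length W" if "P \<ge> 1" using that bW by simp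
  let ?f = "\<lambda>q. card (factor W q ` {a..<b})"
  have img: "factor W q ` {a..<b} = take q ` (factor W p ` {a..<b})" if "q \<le> p" for p q
    using that by (simp add: image_image take_factor)
  have mono: "?f q \<le> ?f p" if "q \<le> p" for p q
    unfolding img[OF that] by (rule card_image_le) simp
  have "?f 0 = 1"
    using len n by (simp add: factor_def image_constant_conv)
  moreover have small: "?f (n - 1) \<le> n - 1"
    using mono[OF Pn] card by simp
  ultimately obtain q where q: "q < n - 1" and fq: "?f q = ?f (Suc q)"
    using stationary_step[of ?f "n - 1"] mono by fastforce
  then have bL: "b \<le> length W" using bL Pn by simp
  \<comment> \<open>\<open>take q\<close> maps the factors of length \<open>q + 1\<close> onto those
    of length \<open>q\<close>; since both sets have the same size, it is injective.\<close>
  have "inj_on (take q) (factor W (Suc q) ` {a..<b})"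
    using fq unfolding img[of q "Suc q", simplified] by (intro eq_card_imp_inj_on) auto
  then have det: "factor W (Suc q) i = factor W (Suc q) j"
    if "factor W q i = factor W q j" "i \<in> {a..<b}" "j \<in> {a..<b}" for i j
    by (rule inj_onD) (use that in \<open>simp_all add: take_factor\<close>)
  have next_eq: "W ! i = W ! j \<and> factor W q (Suc i) = factor W q (Suc j)"
    if "factor W q i = factor W q j" "i \<in> {a..<b}" "j \<in> {a..<b}" for i j
    using det[OF that] that bL by (simp add: factor_Suc_Cons)
  \<comment> \<open>There are \<open>n\<close> starting positions but at most \<open>n - 1\<close>
    factors, so one repeats early: the preperiod \<open>i - a\<close> and the period
    \<open>j - i\<close> are both below \<open>n\<close>.\<close>
  have "\<not> inj_on (factor W q) {a..<a + n}"
  proof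
    assume "inj_on (factor W q) {a..<a + n}"
    then have "n = card (factor W q ` {a..<a + n})" by (simp add: card_image)
    also have "\<dots> \<le> ?f q" using len by (intro card_mono) auto
    also have "\<dots> \<le> ?f (n - 1)" using q by (intro mono) simp
    finally show False using small n by simp
  qed
  then obtain i j where ij: "a \<le> i" "i < j" "j < a + n" "factor W q i = factor W q j"
    unfolding inj_on_def by (metis atLeastLessThan_iff linorder_neqE_nat)
  define d where "d = j - i"
  have shift: "factor W q (i + t) = factor W q (j + t)" if "j + t \<le> b" for t
    using that
  proof (induction t)
    case (Suc t)
    then show ?case using next_eq[of "i + t" "j + t"] ij by auto
  qed (use ij in simp)
  have per: "W ! (i + t) = W ! (i + t + d)" if "i + t + d < b" for t
    using next_eq[OF shift[of t]] that ij unfolding d_def by (auto simp: add.commute)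
  have d: "0 < d" "d < n" "i + d = j" using ij by (auto simp: d_def)
  define w where "w = factor W (b - i) i"
  define v where "v = factor W d i"
  have lw: "length w = b - i" unfolding w_def using bL ij len by (simp add: factor_def)
  have lv: "length v = d" unfolding v_def using bL ij len d by (simp add: factor_def)
  have "w ! t = v ! (t mod d)" if "t < b - i" for t
    using that
  proof (induction t rule: less_induct)
    case (less t)
    have w_nth: "w ! s = W ! (i + s)" if "s < b - i" for s
      using that bL unfolding w_def by (simp add: nth_factor)
    have v_nth: "v ! s = W ! (i + s)" if "s < d" for s
      using that bL d ij len unfolding v_def by (simp add: nth_factor)
    show ?case
    proof (cases "t < d")
      case True
      then show ?thesis using w_nth v_nth less.prems by simp
    next
      case False
      then have "w ! t = w ! (t - d)"
        using w_nth[of t] w_nth[of "t - d"] per[of "t - d"] less.prems by simp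
      also have "\<dots> = v ! ((t - d) mod d)"
        using False d less by simp
      finally show ?thesis using False by (simp add: le_mod_geq)
    qed
  qed
  moreover have "v \<noteq> []" using lv d by auto
  ultimately obtain k r where r: "r < d" and w: "w = word_power v k @ take r v"
    using periodic_word_power[of v w] lw lv by auto
  have vA: "v \<in> lists A" unfolding v_def using W by (rule factor_in_lists)
  then have "v \<in> short_words A n"
    using lv d by (auto simp: short_words_def)
  then have "height_le (short_words A n) (word_power v k) 1" by (rule height_le_power)
  moreover have "height_le (short_words A n) (take r v) 1"
    using vA r d by (intro height_le_short) (auto dest: in_set_takeD)
  moreover have "height_le (short_words A n) (factor W (i - a) a) 1"
    using ij by (intro height_le_short factor_in_lists W) (simp add: factor_def)
  \<comment> \<open>The three powers are the preperiod, the repeated period and its truncated last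
    copy.\<close>
  ultimately have "height_le (short_words A n)
      (factor W (i - a) a @ word_power v k @ take r v) (1 + (1 + 1))"
    by (intro height_le_append)
  moreover have "factor W (b - a) a = factor W (i - a) a @ w"
    using factor_add[of W "i - a" "b - i" a] ij len unfolding w_def by simp
  ultimately show ?thesis using w by (simp add: numeral_3_eq_3)
qed

section \<open>Divisibility and decreasing sequences of factors\<close>

text \<open>Of two words of equal length neither is a proper prefix of the other, so the library
  order is decided at a differing letter.\<close>

lemma word_gt_if_less:
  assumes "v < u" and "length u = length v"
  shows "u \<succ>\<^sub>w v"
proof -
  have "\<exists>w a b u' v'. b < a \<and> u = w @ a # u' \<and> v = w @ b # v'"
    using assms unfolding list_less_def lexord_def by fastforce
  then show ?thesis unfolding word_gt_def by blast
qed

lemma word_gt_append: "u \<succ>\<^sub>w v \<Longrightarrow> (u @ x) \<succ>\<^sub>w (v @ y)"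
  unfolding word_gt_def by (metis append.assoc append_Cons)

lemma take_lex_mono:
  fixes u v :: "'a::linorder list"
  assumes "u \<le> v"
  shows "take p u \<le> take p v"
  using assms
proof (induction p arbitrary: u v)
  case (Suc p)
  then show ?case by (cases u; cases v) auto
qed simp

text \<open>\<open>m\<close> counts steps, so the chain has \<open>m + 1\<close> positions. Steps of
  at least \<open>P\<close> keep consecutive factors disjoint.\<close>

fun desc_chain :: "nat \<Rightarrow> 'a::linorder list \<Rightarrow> nat \<Rightarrow> nat \<Rightarrow> bool" where
  "desc_chain P W 0 i \<longleftrightarrow> True"
| "desc_chain P W (Suc m) i \<longleftrightarrow>
     (\<exists>j. i + P \<le> j \<and> j + P \<le> length W \<and> factor W P j < factor W P i \<and> desc_chain P W m j)"

lemma desc_chain_mono: "desc_chain P W m i \<Longrightarrow> m' \<le> m \<Longrightarrow> desc_chain P W m' i"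
proof (induction m' arbitrary: m i)
  case (Suc m')
  then show ?case by (cases m) auto
qed simp

text \<open>Cut the word at the positions of the chain. Each piece starts with its factor of length
  \<open>P\<close>, within which the comparison is already decided. The clause on
  \<open>hd us\<close> carries this through the induction.\<close>

lemma desc_chain_divides_tail:
  assumes "desc_chain P W m i" and "i + P \<le> length W" and "0 < P"
  shows "\<exists>us. drop i W = concat us \<and> length us = Suc m \<and> [] \<notin> set us \<and>
           successively (\<succ>\<^sub>w) us \<and> P \<le> length (hd us)"
  using assms(1,2)
proof (induction m arbitrary: i)
  case 0
  then show ?case using assms(3) by (intro exI[of _ "[drop i W]"]) auto
next
  case (Suc m)
  then obtain j where j: "i + P \<le> j" "j + P \<le> length W" "factor W P j < factor W P i"
    and "desc_chain P W m j" by auto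
  with Suc.IH[of j] obtain us where us: "drop j W = concat us" "length us = Suc m" "[] \<notin> set us"
    "successively (\<succ>\<^sub>w) us" "P \<le> length (hd us)" by blast
  obtain u us' where us': "us = u # us'" using us(2) by (cases us) auto
  define w where "w = factor W (j - i) i"
  have w: "factor W P i = take P w" "length w = j - i"
    using j unfolding w_def by (auto simp: take_factor length_factor)
  have u: "factor W P j = take P u"
    using us us' by (simp add: factor_def)
  have "take P w \<succ>\<^sub>w take P u"
    using j w u us(5) us' by (intro word_gt_if_less) auto
  from word_gt_append[OF this, of "drop P w" "drop P u"] have "w \<succ>\<^sub>w u" by simp
  moreover have "drop i W = w @ drop j W"
    using append_take_drop_id[of "j - i" "drop i W"] j unfolding w_def factor_def by simp
  moreover have "w \<noteq> []" using w j assms(3) by auto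
  ultimately show ?case
    using us us' w j by (intro exI[of _ "w # us"]) auto
qed

lemma not_divisible_no_desc_chain:
  assumes "\<not> divisible (Suc m) W" and "i + P \<le> length W" and "0 < P"
  shows "\<not> desc_chain P W m i"
proof
  assume "desc_chain P W m i"
  from desc_chain_divides_tail[OF this assms(2,3)]
  obtain us where "drop i W = concat us" "length us = Suc m" "[] \<notin> set us"
    "successively (\<succ>\<^sub>w) us" by blast
  then have "divisible (Suc m) W"
    unfolding divisible_def
    by (intro exI[of _ "take i W"] exI[of _ us]) (metis append_take_drop_id)
  with assms(1) show False by simp
qed

text \<open>The level of \<open>i\<close> is the maximal number of steps of a chain from
  \<open>i\<close>. A smaller factor at a later \<open>j\<close> of the same level would prolong the
  chain of \<open>j\<close>, and \<open>C\<close> steps would give \<open>C + 1\<close> decreasing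
  pieces.\<close>

lemma levels_exist:
  assumes "\<not> divisible (Suc C) W" and "0 < P"
  shows "\<exists>lev. (\<forall>i. i + P \<le> length W \<longrightarrow> lev i < C) \<and>
           (\<forall>i j. i + P \<le> j \<and> j + P \<le> length W \<and> lev i = lev j \<longrightarrow> factor W P i \<le> factor W P j)"
proof -
  define lev where "lev i = (GREATEST m. desc_chain P W m i)" for i
  have bound: "m < C" if "desc_chain P W m i" "i + P \<le> length W" for m i
    using not_divisible_no_desc_chain[OF assms(1) that(2) assms(2)] desc_chain_mono[OF that(1)]
    by (meson not_le)
  have lev: "desc_chain P W (lev i) i" if "i + P \<le> length W" for i
    unfolding lev_def by (rule GreatestI_nat[of _ 0 C]) (use bound that in \<open>auto intro: less_imp_le\<close>)
  have "factor W P i \<le> factor W P j"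
    if ij: "i + P \<le> j" "j + P \<le> length W" and eq: "lev i = lev j" for i j
  proof (rule ccontr)
    assume "\<not> ?thesis"
    then have "desc_chain P W (Suc (lev j)) i" using ij lev[of j] by auto
    then have "Suc (lev j) \<le> lev i"
      unfolding lev_def[of i]
      by (rule Greatest_le_nat[of _ _ C]) (use bound ij in \<open>auto intro: less_imp_le\<close>)
    with eq show False by simp
  qed
  then show ?thesis using lev bound by blast
qed

section \<open>Records\<close>

locale leveled_word =
  fixes W :: "'a::linorder list" and P N C :: nat and lev :: "nat \<Rightarrow> nat"
  assumes P_pos: "0 < P"
    and N_le: "\<And>i. i < N \<Longrightarrow> i + P \<le> length W"
    and lev_less: "\<And>i. i < N \<Longrightarrow> lev i < C"
    and lev_mono: "\<And>i j. i + P \<le> j \<Longrightarrow> j < N \<Longrightarrow> lev i = lev j \<Longrightarrow> factor W P i \<le> factor W P j"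
begin

definition records :: "nat \<Rightarrow> nat set" where
  "records p = {i. i < N \<and> (\<forall>j<i. lev j = lev i \<longrightarrow> factor W p j < factor W p i)}"

lemma finite_records [simp]: "finite (records p)"
  unfolding records_def by simp

lemma records_less: "i \<in> records p \<Longrightarrow> i < N"
  unfolding records_def by simp

lemma zero_in_records: "0 < N \<Longrightarrow> 0 \<in> records p"
  unfolding records_def by simp

lemma records_unique:
  assumes "i \<in> records p" "j \<in> records p" "lev i = lev j" "factor W p i = factor W p j"
  shows "i = j"
  using assms unfolding records_def
  by (metis (mono_tags, lifting) less_irrefl linorder_neqE_nat mem_Collect_eq)

lemma factor_mono:
  assumes "p \<le> P" "i + P \<le> j" "j < N" "lev i = lev j"
  shows "factor W p i \<le> factor W p j"
  using take_lex_mono[OF lev_mono[OF assms(2-4)], of p] assms(1) by (simp add: take_factor)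

text \<open>A position that is not a record is dominated by an earlier one of its level. Repeating
  this leads to \<open>s\<close> or below, as no record stops the descent.\<close>

lemma dominating_record:
  assumes "i < N" and "records p \<inter> {s<..i} = {}"
  shows "\<exists>j\<le>s. lev j = lev i \<and> factor W p i \<le> factor W p j"
  using assms
proof (induction i rule: less_induct)
  case (less i)
  show ?case
  proof (cases "i \<le> s")
    case False
    then have "i \<notin> records p" using less.prems by auto
    then obtain j where j: "j < i" "lev j = lev i" "factor W p i \<le> factor W p j"
      using less.prems unfolding records_def by (auto simp: not_less)
    moreover have "records p \<inter> {s<..j} = {}" using less.prems j by auto
    ultimately show ?thesis
      using less.IH[of j] less.prems by (metis less_trans order_trans)
  qed auto
qed

text \<open>The factor at \<open>i\<close> is dominated at some \<open>k \<le> s\<close>. This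
  \<open>k\<close> lies at least \<open>P\<close> before \<open>j\<close>, so weak growth along the
  level bounds it by the factor at \<open>j\<close>. Exchanging \<open>i\<close> and
  \<open>j\<close> gives equality.\<close>

lemma level_determines_factor:
  assumes "p \<le> P" and "lev i = lev j"
    and "s + P \<le> i" "i < N" "records p \<inter> {s<..i} = {}"
    and "s + P \<le> j" "j < N" "records p \<inter> {s<..j} = {}"
  shows "factor W p i = factor W p j"
proof -
  have "factor W p i \<le> factor W p j"
    if ij: "lev i = lev j" "i < N" "records p \<inter> {s<..i} = {}" "s + P \<le> j" "j < N" for i j
  proof -
    obtain k where "k \<le> s" "lev k = lev i" "factor W p i \<le> factor W p k"
      using dominating_record[OF ij(2,3)] by blast
    moreover from this have "factor W p k \<le> factor W p j"
      using ij assms(1) by (intro factor_mono) auto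
    ultimately show ?thesis by simp
  qed
  from this[of i j] this[of j i] assms show ?thesis by (simp add: order_antisym)
qed

text \<open>A record for length 1 is determined by its level and its letter.\<close>

lemma card_records_one:
  assumes "W \<in> lists A" and "finite A"
  shows "card (records 1) \<le> C * card A"
proof -
  let ?g = "\<lambda>i. (lev i, W ! i)"
  have f1: "factor W 1 i = [W ! i]" if "i < N" for i
    using N_le[OF that] P_pos by (simp add: factor_Suc_Cons) (simp add: factor_def)
  have "inj_on ?g (records 1)"
    using records_unique f1 records_less by (auto simp: inj_on_def)
  moreover have "?g ` records 1 \<subseteq> {..<C} \<times> A"
  proof
    fix x assume "x \<in> ?g ` records 1"
    then obtain i where "i < N" "x = ?g i" using records_less by blast
    moreover from this have "i < length W" using N_le[of i] P_pos by simp
    ultimately show "x \<in> {..<C} \<times> A" using lev_less assms(1) nth_mem by fastforce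
  qed
  ultimately have "card (records 1) \<le> card ({..<C} \<times> A)"
    using assms(2) by (intro card_inj_on_le) auto
  then show ?thesis by (simp add: card_cartesian_product)
qed

text \<open>
  Away from \<open>N\<close> and from the records for length \<open>p\<close>, the factor of length \<open>2 * p\<close> at \<open>i\<close> is
  determined by the levels of \<open>i\<close> and \<open>i + p\<close>.
\<close>

lemma card_records_double:
  assumes "2 * p \<le> P"
  shows "card (insert N (records (2 * p))) \<le> card (insert N (records p)) * (2 * P + C * C)"
proof -
  \<comment> \<open>Both halves of the factor start at least \<open>P\<close> beyond
    \<open>s\<close> with no record for length \<open>p\<close> in between, so
    \<open>level_determines_factor\<close> applies to each half.\<close>
  define D where "D s = {i \<in> records (2 * p). s + P \<le> i \<and> i + p < N \<and>
    records p \<inter> {s<..i + p} = {}}" for s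
  have card_D: "card (D s) \<le> C * C" for s
  proof -
    let ?g = "\<lambda>i. (lev i, lev (i + p))"
    have "i = j" if "i \<in> D s" "j \<in> D s" "lev i = lev j" "lev (i + p) = lev (j + p)" for i j
    proof (rule records_unique[OF _ _ that(3)])
      have sub: "records p \<inter> {s<..x} = {}" if "records p \<inter> {s<..x + p} = {}" for x
        using that by auto
      have "factor W p i = factor W p j" "factor W p (i + p) = factor W p (j + p)"
        using that assms unfolding D_def
        by (auto intro!: level_determines_factor[where s = s] sub)
      then show "factor W (2 * p) i = factor W (2 * p) j"
        by (simp add: factor_add mult_2)
    qed (use that D_def in auto)
    then have "inj_on ?g (D s)" by (auto simp: inj_on_def)
    moreover have "?g ` D s \<subseteq> {..<C} \<times> {..<C}"
      using lev_less by (auto simp: D_def)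
    ultimately have "card (D s) \<le> card ({..<C} \<times> {..<C})"
      by (intro card_inj_on_le) auto
    then show ?thesis by (simp add: card_cartesian_product)
  qed
  \<comment> \<open>The left part of the interval catches positions \<open>i < s\<close> with
    \<open>s \<le> i + p\<close>, and for \<open>s = N\<close> those with
    \<open>i + p \<ge> N\<close>; this is why \<open>N\<close> joins the records.\<close>
  let ?B = "\<lambda>s. {s - P..<s + P} \<union> D s"
  have "insert N (records (2 * p)) \<subseteq> (\<Union>s \<in> insert N (records p). ?B s)"
  proof
    fix i assume i: "i \<in> insert N (records (2 * p))"
    then have iN: "i \<le> N" using records_less by fastforce
    show "i \<in> (\<Union>s \<in> insert N (records p). ?B s)"
    proof (cases "i + p < N")
      case False
      then have "i \<in> ?B N" using iN assms P_pos by auto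
      then show ?thesis by blast
    next
      case True
      let ?R = "records p \<inter> {..i + p}"
      have "0 \<in> ?R" using zero_in_records True by auto
      then have ne: "?R \<noteq> {}" by blast
      define s where "s = Max ?R"
      have s: "s \<in> records p" "s \<le> i + p" using Max_in[of ?R] ne unfolding s_def by auto
      have "records p \<inter> {s<..i + p} = {}"
        using Max_ge[of ?R] unfolding s_def by fastforce
      then have "i \<in> ?B s"
        using i True s assms by (auto simp: D_def)
      then show ?thesis using s by blast
    qed
  qed
  then have "card (insert N (records (2 * p))) \<le> card (\<Union>s \<in> insert N (records p). ?B s)"
    by (intro card_mono) (auto simp: D_def)
  also have "\<dots> \<le> (\<Sum>s \<in> insert N (records p). card (?B s))"
    by (intro card_UN_le) simp
  also have "\<dots> \<le> (\<Sum>s \<in> insert N (records p). 2 * P + C * C)"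
  proof (intro sum_mono)
    fix s
    have "card (?B s) \<le> card {s - P..<s + P} + card (D s)" by (rule card_Un_le)
    then show "card (?B s) \<le> 2 * P + C * C" using card_D[of s] by simp
  qed
  finally show ?thesis by simp
qed

lemma card_records_power:
  assumes "W \<in> lists A" and "finite A" and "2 ^ k \<le> P"
  shows "card (insert N (records (2 ^ k))) \<le> (C * card A + 1) * (2 * P + C * C) ^ k"
  using assms(3)
proof (induction k)
  case 0
  have "card (insert N (records 1)) \<le> Suc (card (records 1))" by (rule card_insert_le_m1) auto
  then show ?case using card_records_one[OF assms(1,2)] by simp
next
  case (Suc k)
  have "card (insert N (records (2 ^ Suc k))) \<le> card (insert N (records (2 ^ k))) * (2 * P + C * C)"
    using card_records_double[of "2 ^ k"] Suc.prems by simp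
  also have "\<dots> \<le> (C * card A + 1) * (2 * P + C * C) ^ k * (2 * P + C * C)"
    using Suc by (intro mult_right_mono) auto
  finally show ?case by (simp only: power_Suc mult_ac)
qed

text \<open>Strip off the stretch from the last record \<open>s\<close> before \<open>b\<close>: its
  first \<open>P\<close> letters count singly and the remainder needs at most three powers, whence
  \<open>P + 3\<close> per record.\<close>

lemma height_le_take:
  assumes W: "W \<in> lists A" and CP: "C \<le> P" and C: "1 \<le> C" and b: "b \<le> N"
  shows "height_le (short_words A (Suc C)) (take b W) ((P + 3) * card (records P \<inter> {..<b}))"
  using b
proof (induction b rule: less_induct)
  case (less b)
  let ?Y = "short_words A (Suc C)"
  show ?case
  proof (cases "b = 0")
    case True
    then show ?thesis by (simp add: height_le_Nil)
  next
    case False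
    let ?R = "records P \<inter> {..<b}"
    have "0 \<in> ?R" using zero_in_records False less.prems by auto
    then have ne: "?R \<noteq> {}" by blast
    define s where "s = Max ?R"
    have s: "s \<in> records P" "s < b" using Max_in[of ?R] ne unfolding s_def by auto
    have gap: "records P \<inter> {s<..<b} = {}"
      using Max_ge[of ?R] unfolding s_def by fastforce
    have "?R = insert s (records P \<inter> {..<s})" using s gap
      by (auto simp: set_eq_iff) (metis linorder_neqE_nat)
    then have card_R: "card ?R = Suc (card (records P \<inter> {..<s}))" by simp
    define c where "c = min b (s + P)"
    have c: "s \<le> c" "c \<le> b" "c \<le> s + P" using s by (auto simp: c_def)
    have "length (factor W (c - s) s) \<le> P" using c by (simp add: factor_def)
    then have h1: "height_le ?Y (factor W (c - s) s) P"
      using height_le_length[OF factor_in_lists[OF W], of "Suc C"] C height_le_mono by fastforce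
    have "card (factor W P ` {c..<b}) \<le> C"
    proof -
      have det: "factor W P i = factor W P j"
        if "i \<in> {c..<b}" "j \<in> {c..<b}" "lev i = lev j" for i j
      proof (rule level_determines_factor[where s = s])
        have "records P \<inter> {s<..x} = {}" if "x < b" for x using gap that by fastforce
        then show "records P \<inter> {s<..i} = {}" "records P \<inter> {s<..j} = {}" using that by auto
      qed (use that less.prems in \<open>auto simp: c_def\<close>)
      \<comment> \<open>\<open>?h\<close> picks one position on each level, so there are no more
        factors than levels.\<close>
      let ?h = "\<lambda>m. factor W P (inv_into {c..<b} lev m)"
      have "factor W P ` {c..<b} \<subseteq> ?h ` {..<C}"
      proof
        fix x assume "x \<in> factor W P ` {c..<b}"
        then obtain i where i: "i \<in> {c..<b}" "x = factor W P i" by blast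
        then have "lev i \<in> lev ` {c..<b}" by blast
        then have "x = ?h (lev i)"
          unfolding i(2) by (intro det i inv_into_into f_inv_into_f[symmetric])
        then show "x \<in> ?h ` {..<C}" using lev_less[of i] i less.prems by auto
      qed
      then have "card (factor W P ` {c..<b}) \<le> card (?h ` {..<C})"
        by (intro card_mono) auto
      also have "\<dots> \<le> card {..<C}" by (rule card_image_le) simp
      finally show ?thesis by simp
    qed
    moreover have "b + P \<le> length W + 1" using N_le[of "b - 1"] False less.prems by linarith
    ultimately have h2: "height_le ?Y (factor W (b - c) c) 3"
      using height_le_few_factors[OF W, of "Suc C" P b c] CP c by simp
    have h0: "height_le ?Y (take s W) ((P + 3) * card (records P \<inter> {..<s}))"
      using less.IH[of s] s less.prems by simp
    have "take b W = factor W (s + (c - s) + (b - c)) 0"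
      using c by (simp add: factor_def)
    also have "\<dots> = (take s W @ factor W (c - s) s) @ factor W (b - c) c"
      unfolding factor_add using c by (simp add: factor_def)
    finally show ?thesis
      using height_le_append[OF height_le_append[OF h0 h1] h2] card_R by (simp add: algebra_simps)
  qed
qed

end

section \<open>The number of powers in terms of \<open>C\<close> and \<open>k\<close>\<close>

theorem height_le_not_divisible:
  fixes W :: "'a::linorder list"
  assumes W: "W \<in> lists A" and A: "finite A" and nd: "\<not> divisible (Suc C) W"
    and C: "1 \<le> C" "C \<le> 2 ^ k"
  shows "height_le (short_words A (Suc C)) W
    ((2 ^ k + 3) * ((C * card A + 1) * (2 * 2 ^ k + C * C) ^ k))"
proof -
  define P :: nat where "P = 2 ^ k"
  define N where "N = length W - P"
  let ?Y = "short_words A (Suc C)"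
  have P: "0 < P" by (simp add: P_def)
  obtain lev where lev: "\<And>i. i + P \<le> length W \<Longrightarrow> lev i < C"
    "\<And>i j. i + P \<le> j \<Longrightarrow> j + P \<le> length W \<Longrightarrow> lev i = lev j \<Longrightarrow> factor W P i \<le> factor W P j"
    using levels_exist[OF nd P] by blast
  interpret leveled_word W P N C lev
    using P lev by unfold_locales (auto simp: N_def)
  have "records P \<inter> {..<N} = records P" using records_less by auto
  then have h: "height_le ?Y (take N W) ((P + 3) * card (records P))"
    using height_le_take[OF W, of N] C by (simp add: P_def)
  \<comment> \<open>The remaining letters, at most \<open>P\<close> of them, are written singly.
    Allowing \<open>P + 3\<close> factors for them makes \<open>N\<close> count as one more
    record.\<close>
  have "drop N W \<in> lists A" using W by (auto dest: in_set_dropD)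
  then have "height_le ?Y (drop N W) (P + 3)"
    using height_le_length[of "drop N W" A "Suc C"] C height_le_mono by (fastforce simp: N_def)
  from height_le_append[OF h this]
  have "height_le ?Y W ((P + 3) * Suc (card (records P)))"
    by (simp add: algebra_simps)
  moreover have "Suc (card (records P)) = card (insert N (records P))"
    using records_less by (subst card_insert_disjoint) auto
  ultimately have "height_le ?Y W ((P + 3) * card (insert N (records P)))"
    by simp
  moreover have "card (insert N (records P)) \<le> (C * card A + 1) * (2 * P + C * C) ^ k"
    using card_records_power[OF W A, of k] by (simp add: P_def)
  ultimately show ?thesis
    unfolding P_def[symmetric] by (meson height_le_mono mult_le_mono2)
qed

section \<open>The numerical estimate\<close>

lemma ex_power_two_between:
  assumes "1 \<le> (m::nat)"
  shows "\<exists>k. m \<le> 2 ^ k \<and> 2 ^ k \<le> 2 * m"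
proof -
  define k where "k = (LEAST k. m \<le> 2 ^ k)"
  have ex: "m \<le> 2 ^ m" by (simp add: less_imp_le)
  have k: "m \<le> 2 ^ k" unfolding k_def using ex by (rule LeastI)
  have "2 ^ k \<le> 2 * m"
  proof (cases k)
    case (Suc j)
    then have "\<not> m \<le> 2 ^ j" using not_less_Least[of j "\<lambda>k. m \<le> 2 ^ k"] by (simp add: k_def)
    then show ?thesis using Suc by simp
  qed (use assms in simp)
  with k show ?thesis by blast
qed

text \<open>The product is at most \<open>4 * l * n ^ (2 + 4 * k)\<close>, and
  \<open>3 ^ k \<le> (2 ^ k) ^ 2\<close> gives \<open>k \<le> 2 + 2 * log 3 n\<close>. So the
  exponent is at most \<open>10 + 8 * log 3 n\<close>, which the wanted one exceeds because the
  iterated logarithm is at least -1.\<close>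

lemma record_bound_le_height_bound:
  assumes C: "1 \<le> C" and l: "1 \<le> l" and k: "2 ^ k \<le> 2 * C"
  shows "real ((2 ^ k + 3) * ((C * l + 1) * (2 * 2 ^ k + C * C) ^ k)) \<le> height_bound (Suc C) l"
proof -
  define n where "n = Suc C"
  have n: "2 \<le> n" using C by (simp add: n_def)
  have "2 ^ k + 3 \<le> 4 * n" using k by (simp add: n_def)
  moreover have "C * l + 1 \<le> n * l" using l by (simp add: n_def)
  moreover have "2 * 2 ^ k + C * C \<le> n ^ 4"
  proof -
    have "2 * 2 ^ k + C * C \<le> (C + 2) * (C + 2)" using k by simp
    also have "\<dots> \<le> (n * n) * (n * n)"
    proof -
      have "C + 2 \<le> n * n" using mult_le_mono1[OF n, of n] n by (simp add: n_def)
      then show ?thesis by (rule mult_le_mono) fact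
    qed
    finally show ?thesis by (simp add: power4_eq_xxxx mult_ac)
  qed
  ultimately have "(2 ^ k + 3) * ((C * l + 1) * (2 * 2 ^ k + C * C) ^ k)
      \<le> (4 * n) * ((n * l) * (n ^ 4) ^ k)"
    by (intro mult_le_mono power_mono) auto
  also have "\<dots> = 4 * l * n ^ (2 + 4 * k)"
    by (simp add: power_add power_mult[symmetric] power2_eq_square)
  finally have "real ((2 ^ k + 3) * ((C * l + 1) * (2 * 2 ^ k + C * C) ^ k))
      \<le> real (4 * l * n ^ (2 + 4 * k))"
    by (simp only: of_nat_le_iff)
  also have "\<dots> = 4 * real l * real n powr (2 + 4 * real k)"
    using n powr_realpow[of "real n" "2 + 4 * k"] by simp
  also have "\<dots> \<le> 2 ^ 96 * real l * real n powr (12 * log 3 n + 36 * log 3 (log 3 n) + 91)"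
  proof (intro mult_mono powr_mono)
    \<comment> \<open>The iterated logarithm is negative for \<open>n = 2\<close>; this bound keeps
      it from falling below -1.\<close>
    have "(3::real) powr (1/3) \<le> 2"
    proof -
      have "(3::real) powr (1/3) \<le> (2 ^ 3) powr (1/3)" by (intro powr_mono2) auto
      also have "\<dots> = 2" by (simp add: powr_powr flip: powr_numeral)
      finally show ?thesis .
    qed
    then have "1/3 \<le> log 3 (real n)" using n by (subst le_log_iff) auto
    then have "log 3 (1/3) \<le> log 3 (log 3 n)" by (subst log_le_cancel_iff) auto
    then have ll: "- 1 \<le> log 3 (log 3 n)" by (simp add: log_divide)
    have "(3::real) ^ k \<le> 4 ^ k" by (intro power_mono) auto
    also have "\<dots> = (2 ^ k) ^ 2"
      by (simp add: power2_eq_square flip: power_mult_distrib)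
    finally have "log 3 ((3::real) ^ k) \<le> log 3 ((2 ^ k) ^ 2)"
      by (subst log_le_cancel_iff) auto
    then have "real k \<le> log 3 ((2 ^ k) ^ 2)" by (simp add: log_nat_power)
    also have "\<dots> \<le> log 3 ((2 * real n) ^ 2)"
    proof -
      have "(2::real) ^ k \<le> 2 * real n"
        using k by (simp add: n_def flip: of_nat_le_iff[where ?'a = real])
      then have "((2::real) ^ k) ^ 2 \<le> (2 * real n) ^ 2" by (intro power_mono) auto
      then show ?thesis using n by (subst log_le_cancel_iff) auto
    qed
    also have "\<dots> = 2 * log 3 (2 * real n)" using n by (subst log_nat_power) auto
    also have "log 3 (2 * real n) = log 3 2 + log 3 n" using n by (simp add: log_mult)
    also have "log 3 2 \<le> log 3 (3::real)" by (subst log_le_cancel_iff) auto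
    finally have "real k \<le> 2 + 2 * log 3 n" by simp
    with ll \<open>1/3 \<le> log 3 (real n)\<close>
    show "2 + 4 * real k \<le> 12 * log 3 n + 36 * log 3 (log 3 n) + 91" by simp
  qed (use n in auto)
  finally show ?thesis by (simp add: height_bound_def n_def)
qed

section \<open>From a uniform number of powers to the height\<close>

theorem theorem1p7p2:
  fixes n l :: nat and A :: "'a::linorder set"
  assumes "n \<ge> 1" and "l \<ge> 1" and "finite A" and "card A = l"
  shows "(\<forall>W \<in> lists A. \<not> divisible n W \<longrightarrow>
            (\<exists>fs. power_factorization (short_words A n) W fs \<and>
                  real (length fs) \<le> height_bound n l)) \<and>
         ereal_of_enat (height n {W \<in> lists A. \<not> divisible n W} (short_words A n))
           \<le> ereal (height_bound n l)"
proof -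
  \<comment> \<open>One natural number \<open>h\<close> must serve all words in order to bound the
    infimum in \<open>height\<close>.\<close>
  have "\<exists>h. real h \<le> height_bound n l \<and>
    (\<forall>W \<in> lists A. \<not> divisible n W \<longrightarrow> height_le (short_words A n) W h)"
  proof (cases "n = 1")
    case True
    \<comment> \<open>No nonempty word is shorter than 1, but the only word that is not 1-divisible
      is the empty product.\<close>
    have "W = []" if "\<not> divisible 1 W" for W :: "'a list"
    proof (rule ccontr)
      assume "W \<noteq> []"
      then have "divisible 1 W"
        unfolding divisible_def by (intro exI[of _ "[]"] exI[of _ "[W]"]) simp
      with that show False by simp
    qed
    then have "\<forall>W \<in> lists A. \<not> divisible n W \<longrightarrow> height_le (short_words A n) W 0"
      using True height_le_Nil by metis
    moreover have "real 0 \<le> height_bound n l" by (simp add: height_bound_def)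
    ultimately show ?thesis by blast
  next
    case False
    then obtain C where C: "n = Suc C" "1 \<le> C" using assms(1) by (cases n) auto
    obtain k where k: "C \<le> 2 ^ k" "2 ^ k \<le> 2 * C" using ex_power_two_between[OF C(2)] by blast
    show ?thesis
      using height_le_not_divisible[OF _ assms(3) _ C(2) k(1)]
        record_bound_le_height_bound[OF C(2) assms(2) k(2)] assms(4) C(1) by blast
  qed
  then obtain h where h: "real h \<le> height_bound n l"
    and *: "\<And>W. W \<in> lists A \<Longrightarrow> \<not> divisible n W \<Longrightarrow>
      \<exists>fs. power_factorization (short_words A n) W fs \<and> length fs \<le> h"
    unfolding height_le_def by blast
  have "height n {W \<in> lists A. \<not> divisible n W} (short_words A n) \<le> enat h"
    unfolding height_def using * by (intro Inf_lower) auto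
  then have "ereal_of_enat (height n {W \<in> lists A. \<not> divisible n W} (short_words A n))
      \<le> ereal_of_enat (enat h)"
    by (simp only: ereal_of_enat_le_iff)
  also have "\<dots> \<le> ereal (height_bound n l)" using h by simp
  finally show ?thesis
    using * h by (metis of_nat_le_iff order_trans)
qed

end
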